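(* Let $\mathbb{F}_q$ be a finite field with $q$ elements, let $D\subsetneq\mathbb{F}_q$ be an evaluation set of cardinality $n$, and let $C=GRS_k(\mathbb{F}_q,D)$ be the generalized Reed-Solomon code of length $n$ and dimension $k$. Then for every $b\in\mathbb{F}_q\setminus D$, every $a\in\mathbb{F}_q$ with $a\neq 0$, and every polynomial $h(x)\in\mathbb{F}_q[x]$ of degree at most $k-1$, the polynomial $f(x)=a(x-b)^{q-2}+h(x)$ defines a deep hole of $GRS_k(\mathbb{F}_q,D)$, i.e. $d(u_f,C)=n-k$.
   Context: Let $D=\{x_1,\dots,x_n\}\subseteq\mathbb{F}_q$ with $x_1,\dots,x_n$ distinct and $1\le k\le n$. The generalized Reed-Solomon code is $GRS_k(\mathbb{F}_q,D)=\{(g(x_1),\dots,g(x_n))\in\mathbb{F}_q^n : g\in\mathbb{F}_q[x],\ \deg g\le k-1\}$ (the zero polynomial is allowed). For $f\in\mathbb{F}_q[x]$, the word defined by $f$ is $u_f=(f(x_1),\dots,f(x_n))$. The Hamming distance is $d(u,v)=\#\{i: u_i\ne v_i\}$ and the error distance is $d(u,C)=\min\{d(u,v): v\in C\}$. A word $u\in\mathbb{F}_q^n$ is a deep hole of $C=GRS_k(\mathbb{F}_q,D)$ if $d(u,C)=n-k$; a polynomial $f$ is said to define a deep hole if $u_f$ is one. *)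

theory Defs
  imports "HOL-Library.Cardinality" "HOL-Computational_Algebra.Polynomial"
begin

text \<open>
  The evaluation set is given by an enumeration \<open>xs = [x\<^sub>1, \<dots>, x\<^sub>n]\<close> (without repetitions) of its
  elements; words in $F_q^n$ are lists of length \<open>n = length xs\<close>.
\<close>

definition word_of :: "'a::comm_semiring_0 list \<Rightarrow> 'a poly \<Rightarrow> 'a list" where
  "word_of xs f = map (poly f) xs"

text \<open>
  Meant for \<open>1 \<le> k\<close>. As \<open>degree 0 = 0\<close>, the zero polynomial is included.
\<close>

definition GRS :: "nat \<Rightarrow> 'a::comm_semiring_0 list \<Rightarrow> 'a list set" where
  "GRS k xs = {word_of xs g | g. degree g \<le> k - 1}"

text \<open>Only used for words of equal length.\<close>

definition hamming_dist :: "'a list \<Rightarrow> 'a list \<Rightarrow> nat" where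
  "hamming_dist u v = card {i. i < length u \<and> u ! i \<noteq> v ! i}"

definition error_dist :: "'a list \<Rightarrow> 'a list set \<Rightarrow> nat" where
  "error_dist u C = Min {hamming_dist u v | v. v \<in> C}"

definition deep_hole :: "nat \<Rightarrow> 'a::comm_semiring_0 list \<Rightarrow> 'a list \<Rightarrow> bool" where
  "deep_hole k xs u \<longleftrightarrow>
     length u = length xs \<and> error_dist u (GRS k xs) = length xs - k"

definition defines_deep_hole :: "nat \<Rightarrow> 'a::comm_semiring_0 list \<Rightarrow> 'a poly \<Rightarrow> bool" where
  "defines_deep_hole k xs f \<longleftrightarrow> deep_hole k xs (word_of xs f)"

end

theory Submission imports Defs begin

text \<open>
  Off \<open>b\<close> the polynomial \<open>(x - b)^(q - 2)\<close> takes the values \<open>1 / (x - b)\<close>. Hence \<open>f\<close> and a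
  codeword polynomial \<open>g\<close> agree at a point of \<open>D\<close> iff that point is a root of
  \<open>a + (x - b) (h - g)\<close>, a polynomial of degree at most \<open>k\<close> with value \<open>a \<noteq> 0\<close> at \<open>b\<close>; so there are
  at most \<open>k\<close> agreements. Prescribing any \<open>k\<close> roots in \<open>D\<close> together with the value \<open>a\<close> at \<open>b\<close>
  shows that \<open>k\<close> agreements are attained.
\<close>

text \<open>
  The library's \<open>finite_field_power_card_eq_same\<close> is stated for the class \<open>finite_field\<close>, which the
  sort \<open>{field,finite}\<close> does not imply syntactically.
\<close>

lemma power_card_minus_1_eq_1:
  fixes y :: "'a::{field,finite}"
  assumes "y \<noteq> 0"
  shows "y ^ (CARD('a) - 1) = 1"
proof -
  let ?U = "UNIV - {0::'a}"
  \<comment> \<open>Multiplication by \<open>y\<close> permutes the nonzero elements, so it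
    preserves their product; it also scales that product by \<open>y ^ card ?U\<close>.\<close>
  have "bij_betw ((*) y) ?U ?U"
    by (rule bij_betw_byWitness[where f' = "\<lambda>z. z / y"]) (use assms in auto)
  from prod.reindex_bij_betw[OF this, of "\<lambda>z. z"]
  have "y ^ card ?U * \<Prod>?U = \<Prod>?U"
    by (simp only: prod.distrib prod_constant)
  moreover have "\<Prod>?U \<noteq> 0"
    by simp
  ultimately have "y ^ card ?U = 1"
    using mult_cancel_right[of "y ^ card ?U" "\<Prod>?U" 1] by (simp only: mult_1 simp_thms)
  then show ?thesis
    by (simp add: card_Diff_singleton)
qed

lemma power_card_minus_2_eq_inverse:
  fixes y :: "'a::{field,finite}"
  assumes "y \<noteq> 0"
  shows "y ^ (CARD('a) - 2) = inverse y"
proof -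
  \<comment> \<open>As \<open>0\<close> and \<open>1\<close> are distinct, the subtraction in
    \<open>CARD('a) - 2\<close> does not truncate.\<close>
  have "card {0, 1::'a} \<le> CARD('a)"
    by (intro card_mono) auto
  then have "CARD('a) - 1 = Suc (CARD('a) - 2)"
    by simp
  then have "y * y ^ (CARD('a) - 2) = 1"
    using power_card_minus_1_eq_1[OF assms] by simp
  then show ?thesis
    by (simp add: inverse_unique)
qed

lemma hamming_dist_word_of:
  assumes "distinct xs"
  shows "hamming_dist (word_of xs f) (word_of xs g) = card {x \<in> set xs. poly f x \<noteq> poly g x}"
proof -
  have "{x \<in> set xs. poly f x \<noteq> poly g x} =
      (!) xs ` {i. i < length xs \<and> poly f (xs ! i) \<noteq> poly g (xs ! i)}"
    by (auto simp: in_set_conv_nth)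
  moreover have "inj_on ((!) xs) {i. i < length xs \<and> poly f (xs ! i) \<noteq> poly g (xs ! i)}"
    using assms by (auto simp: inj_on_def nth_eq_iff_index_eq)
  ultimately have "card {x \<in> set xs. poly f x \<noteq> poly g x} =
      card {i. i < length xs \<and> poly f (xs ! i) \<noteq> poly g (xs ! i)}"
    by (simp add: card_image)
  also have "{i. i < length xs \<and> poly f (xs ! i) \<noteq> poly g (xs ! i)} =
      {i. i < length (word_of xs f) \<and> word_of xs f ! i \<noteq> word_of xs g ! i}"
    by (auto simp: word_of_def)
  finally show ?thesis
    by (simp add: hamming_dist_def)
qed

lemma hamming_dist_le_length: "hamming_dist u v \<le> length u"
proof -
  have "hamming_dist u v \<le> card {..<length u}"
    unfolding hamming_dist_def by (intro card_mono) auto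
  then show ?thesis by simp
qed

lemma error_dist_eqI:
  assumes "\<And>v. v \<in> C \<Longrightarrow> m \<le> hamming_dist u v" and "v \<in> C" and "hamming_dist u v \<le> m"
  shows "error_dist u C = m"
  unfolding error_dist_def
proof (rule Min_eqI)
  \<comment> \<open>Even for infinite \<open>C\<close>, \<open>Min\<close> ranges over a finite set,
    since distances are bounded by \<open>length u\<close>.\<close>
  have "{hamming_dist u v | v. v \<in> C} \<subseteq> {..length u}"
    using hamming_dist_le_length by auto
  then show "finite {hamming_dist u v | v. v \<in> C}"
    by (rule finite_subset) simp
  show "m \<in> {hamming_dist u v | v. v \<in> C}"
    using assms by (auto intro!: exI[of _ v] le_antisym)
qed (use assms in auto)

text \<open>A polynomial equal to \<open>a\<close> on \<open>S\<close> and vanishing at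
  \<open>b\<close> is divisible by \<open>x - b\<close>, and the quotient has the required values.
  Starting from degree at most \<open>card S\<close>, the division lowers the degree by one.\<close>

lemma interpolating_simple_pole:
  fixes a b :: "'a::field"
  assumes "finite S" "b \<notin> S"
  obtains w where "degree w \<le> card S - 1" "\<And>x. x \<in> S \<Longrightarrow> poly w x = a / (x - b)"
proof -
  define P where "P = (\<Prod>s\<in>S. [:- s, 1:])"
  \<comment> \<open>\<open>P\<close> vanishes on \<open>S\<close>, so \<open>r\<close> is
    \<open>a\<close> there; the scalar is chosen to make \<open>b\<close> a root of
    \<open>r\<close>.\<close>
  define r where "r = [:a:] - smult (a / poly P b) P"
  have Pb: "poly P b \<noteq> 0"
    using assms by (auto simp: P_def poly_prod)
  then have "poly r b = 0"
    by (simp add: r_def)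
  then obtain w where w: "r = [:- b, 1:] * w"
    by (auto simp: poly_eq_0_iff_dvd)
  have "degree P \<le> card S"
    unfolding P_def using degree_prod_sum_le[OF assms(1), of "\<lambda>s. [:- s, 1:]"] by simp
  then have "degree r \<le> card S"
    unfolding r_def by (intro degree_diff_le degree_smult_le[THEN order_trans]) auto
  moreover have "degree r = Suc (degree w)" if "w \<noteq> 0"
    using that unfolding w by (subst degree_mult_eq) auto
  \<comment> \<open>The case \<open>w = 0\<close>, forced when \<open>S\<close> is empty, relies on
    \<open>degree 0 = 0\<close>.\<close>
  ultimately have "degree w \<le> card S - 1"
    by (cases "w = 0") auto
  moreover have "poly w x = a / (x - b)" if "x \<in> S" for x
  proof -
    have "poly P x = 0"
      using that assms by (auto simp: P_def poly_prod)
    then have "a = poly r x"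
      by (simp add: r_def)
    also have "\<dots> = (x - b) * poly w x"
      by (simp add: w algebra_simps)
    finally have "a = (x - b) * poly w x" .
    moreover have "x - b \<noteq> 0"
      using that assms by auto
    ultimately show ?thesis
      by simp
  qed
  ultimately show ?thesis
    using that by blast
qed

text \<open>Clearing the denominator makes each counted point a root of
  \<open>(x - b) * p - a\<close>, which has degree at most \<open>k\<close> and is nonzero because
  its value at \<open>b\<close> is \<open>- a\<close>.\<close>

lemma card_agree_simple_pole_le:
  fixes a b :: "'a::field" and p :: "'a poly"
  assumes "a \<noteq> 0" and "b \<notin> S" and "degree p \<le> k - 1" and "1 \<le> k"
  shows "card {x \<in> S. poly p x = a / (x - b)} \<le> k"
proof -
  define r where "r = [:- b, 1:] * p - [:a:]"
  have "poly r b \<noteq> 0"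
    using assms by (simp add: r_def)
  then have "r \<noteq> 0"
    by auto
  have "degree ([:- b, 1:] * p) \<le> k"
    using degree_mult_le[of "[:- b, 1:]" p] assms by simp
  then have "degree r \<le> k"
    unfolding r_def by (intro degree_diff_le) auto
  have "poly r x = 0" if "x \<in> S" "poly p x = a / (x - b)" for x
  proof -
    have "x - b \<noteq> 0"
      using that assms by auto
    then have "(x - b) * poly p x = a"
      using that by simp
    then show ?thesis
      by (simp add: r_def algebra_simps)
  qed
  then have "{x \<in> S. poly p x = a / (x - b)} \<subseteq> {x. poly r x = 0}"
    by auto
  then have "card {x \<in> S. poly p x = a / (x - b)} \<le> card {x. poly r x = 0}"
    using \<open>r \<noteq> 0\<close> by (intro card_mono poly_roots_finite)
  also have "\<dots> \<le> degree r"
    using \<open>r \<noteq> 0\<close> by (rule card_poly_roots_bound)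
  finally show ?thesis
    using \<open>degree r \<le> k\<close> by simp
qed

theorem theorem2p2:
  fixes D :: "'a::{field,finite} set" and xs :: "'a list"
    and q n k :: nat and a b :: 'a and h :: "'a poly"
  assumes "q = CARD('a)"
    and "D \<subset> UNIV" and "card D = n"
    and "set xs = D" and "distinct xs"
    and "1 \<le> k" and "k \<le> n"
    and "b \<in> UNIV - D" and "a \<noteq> 0"
    and "degree h \<le> k - 1"
  shows "defines_deep_hole k xs (smult a ([:- b, 1:] ^ (q - 2)) + h)"
proof -
  define f where "f = smult a ([:- b, 1:] ^ (q - 2)) + h"
  have b: "b \<notin> D" and len: "length xs = n"
    using assms distinct_card by fastforce+
  have f: "poly f x = a / (x - b) + poly h x" if "x \<in> D" for x
  proof -
    have "x - b \<noteq> 0"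
      using that b by auto
    from power_card_minus_2_eq_inverse[OF this] show ?thesis
      using assms(1) by (simp add: f_def poly_power divide_inverse)
  qed
  \<comment> \<open>Subtracting \<open>h\<close> turns agreement of \<open>f\<close> and
    \<open>g\<close> into agreement of \<open>g - h\<close> with the simple pole, the form in which
    both bounds are proved.\<close>
  have dist: "hamming_dist (word_of xs f) (word_of xs g) =
      n - card {x \<in> D. poly (g - h) x = a / (x - b)}" for g
  proof -
    have "hamming_dist (word_of xs f) (word_of xs g) = card {x \<in> D. poly f x \<noteq> poly g x}"
      using assms by (simp add: hamming_dist_word_of)
    also have "{x \<in> D. poly f x \<noteq> poly g x} = D - {x \<in> D. poly (g - h) x = a / (x - b)}"
      by (auto simp: f algebra_simps)
    also have "card \<dots> = n - card {x \<in> D. poly (g - h) x = a / (x - b)}"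
      using assms by (subst card_Diff_subset) auto
    finally show ?thesis .
  qed
  obtain S where S: "S \<subseteq> D" "card S = k"
    using assms by (meson obtain_subset_with_card_n)
  moreover have "b \<notin> S"
    using S b by auto
  ultimately obtain w where w: "degree w \<le> k - 1" "\<And>x. x \<in> S \<Longrightarrow> poly w x = a / (x - b)"
    using interpolating_simple_pole[of S b a] by (metis finite)
  have "error_dist (word_of xs f) (GRS k xs) = n - k"
  proof (rule error_dist_eqI)
    \<comment> \<open>Adding \<open>h\<close> cancels the subtraction in \<open>dist\<close>, so
      \<open>w + h\<close> agrees with \<open>f\<close> at least on \<open>S\<close>.\<close>
    show "word_of xs (w + h) \<in> GRS k xs"
      using w assms by (auto simp: GRS_def intro!: exI[of _ "w + h"] degree_add_le)
    have "card S \<le> card {x \<in> D. poly w x = a / (x - b)}"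
      using S w by (intro card_mono) auto
    then show "hamming_dist (word_of xs f) (word_of xs (w + h)) \<le> n - k"
      unfolding dist using S by simp
  next
    fix v assume "v \<in> GRS k xs"
    then obtain g where g: "v = word_of xs g" "degree g \<le> k - 1"
      by (auto simp: GRS_def)
    then have "degree (g - h) \<le> k - 1"
      using assms by (intro degree_diff_le)
    then have "card {x \<in> D. poly (g - h) x = a / (x - b)} \<le> k"
      using b assms by (intro card_agree_simple_pole_le)
    then show "n - k \<le> hamming_dist (word_of xs f) v"
      unfolding g dist by simp
  qed
  then show ?thesis
    using len by (simp add: defines_deep_hole_def deep_hole_def f_def word_of_def)
qed

end
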